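(* Let $\mathcal{P}$ be a projective plane of order $n\ge 5$ and let $A,B,C$ be three non-collinear points of $\mathcal{P}$. Delete from $\mathcal{P}$ all points lying on the lines $AB$, $AC$, $BC$ and all lines passing through $A$, $B$ or $C$. The remaining points and lines (with the induced incidence) form a strongly regular configuration with parameters $(v_k;\lambda,\mu)$ where $v=(n-1)^2$, $k=n-2$, $\lambda=(n-4)^2+1$, $\mu=(n-3)(n-4)$. Moreover, this configuration is not an $(\alpha,\beta)$-geometry.
   Context: A symmetric $(v_k)$ configuration is a finite incidence structure of $v$ points and $v$ lines such that every line has exactly $k$ points, every point lies on exactly $k$ lines, and two distinct points lie on at most one common line. Its point graph has the points as vertices, two distinct points adjacent iff they lie on a common line. A strongly regular configuration with parameters $(v_k;\lambda,\mu)$ is a symmetric $(v_k)$ configuration whose point graph is a strongly regular graph $SRG(v,k(k-1),\lambda,\mu)$. An $(\alpha,\beta)$-geometry is a configuration for which there are constants $\alpha,\beta$ such that for every non-incident point–line pair $(P,\ell)$, the number of points on $\ell$ collinear with $P$ is either $\alpha$ or $\beta$. *)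

theory Defs
  imports Main
begin

text \<open>
  The incidence predicate is only ever consulted on pairs of a point in the carrier
  and a line in the carrier; passing to a substructure therefore means shrinking the two
  carriers and keeping the predicate (induced incidence).
\<close>

record ('p, 'l) incidence_structure =
  points :: "'p set"
  lines :: "'l set"
  inc :: "'p \<Rightarrow> 'l \<Rightarrow> bool"

definition points_on :: "('p, 'l) incidence_structure \<Rightarrow> 'l \<Rightarrow> 'p set" where
  "points_on S l = {P \<in> points S. inc S P l}"

definition lines_through :: "('p, 'l) incidence_structure \<Rightarrow> 'p \<Rightarrow> 'l set" where
  "lines_through S P = {l \<in> lines S. inc S P l}"

definition collinear3 :: "('p, 'l) incidence_structure \<Rightarrow> 'p \<Rightarrow> 'p \<Rightarrow> 'p \<Rightarrow> bool" where
  "collinear3 S P Q R \<longleftrightarrow> (\<exists>l\<in>lines S. inc S P l \<and> inc S Q l \<and> inc S R l)"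

definition projective_plane :: "('p, 'l) incidence_structure \<Rightarrow> bool" where
  "projective_plane S \<longleftrightarrow>
     (\<forall>P\<in>points S. \<forall>Q\<in>points S. P \<noteq> Q \<longrightarrow> (\<exists>!l. l \<in> lines S \<and> inc S P l \<and> inc S Q l)) \<and>
     (\<forall>l\<in>lines S. \<forall>m\<in>lines S. l \<noteq> m \<longrightarrow> (\<exists>!P. P \<in> points S \<and> inc S P l \<and> inc S P m)) \<and>
     (\<exists>P\<in>points S. \<exists>Q\<in>points S. \<exists>R\<in>points S. \<exists>T\<in>points S.
        distinct [P, Q, R, T] \<and>
        \<not> collinear3 S P Q R \<and> \<not> collinear3 S P Q T \<and>
        \<not> collinear3 S P R T \<and> \<not> collinear3 S Q R T)"

text \<open>
  Finiteness need not be demanded separately: \<^const>\<open>card\<close> of an infinite set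
  is \<open>0\<close>, so every line has finitely many points and the plane is finite.
\<close>

definition projective_plane_of_order :: "('p, 'l) incidence_structure \<Rightarrow> nat \<Rightarrow> bool" where
  "projective_plane_of_order S n \<longleftrightarrow>
     projective_plane S \<and> (\<forall>l\<in>lines S. card (points_on S l) = n + 1)"

definition join :: "('p, 'l) incidence_structure \<Rightarrow> 'p \<Rightarrow> 'p \<Rightarrow> 'l" where
  "join S P Q = (THE l. l \<in> lines S \<and> inc S P l \<and> inc S Q l)"

definition delete_triangle ::
    "('p, 'l) incidence_structure \<Rightarrow> 'p \<Rightarrow> 'p \<Rightarrow> 'p \<Rightarrow> ('p, 'l) incidence_structure" where
  "delete_triangle S A B C =
     \<lparr> points = {P \<in> points S. \<not> inc S P (join S A B) \<and> \<not> inc S P (join S A C) \<and>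
                              \<not> inc S P (join S B C)},
       lines = {l \<in> lines S. \<not> inc S A l \<and> \<not> inc S B l \<and> \<not> inc S C l},
       inc = inc S \<rparr>"

definition symmetric_configuration ::
    "('p, 'l) incidence_structure \<Rightarrow> nat \<Rightarrow> nat \<Rightarrow> bool" where
  "symmetric_configuration S v k \<longleftrightarrow>
     finite (points S) \<and> card (points S) = v \<and>
     finite (lines S) \<and> card (lines S) = v \<and>
     (\<forall>l\<in>lines S. finite (points_on S l) \<and> card (points_on S l) = k) \<and>
     (\<forall>P\<in>points S. finite (lines_through S P) \<and> card (lines_through S P) = k) \<and>
     (\<forall>P\<in>points S. \<forall>Q\<in>points S. P \<noteq> Q \<longrightarrow>
        (\<forall>l\<in>lines S. \<forall>m\<in>lines S.
           inc S P l \<and> inc S Q l \<and> inc S P m \<and> inc S Q m \<longrightarrow> l = m))"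

text \<open>The adjacency relation of the point graph, whose vertex set is \<open>points S\<close>.\<close>

definition point_adj :: "('p, 'l) incidence_structure \<Rightarrow> 'p \<Rightarrow> 'p \<Rightarrow> bool" where
  "point_adj S P Q \<longleftrightarrow> P \<noteq> Q \<and> (\<exists>l\<in>lines S. inc S P l \<and> inc S Q l)"

text \<open>
  A finite simple graph is given by its vertex set and an adjacency relation. Following the
  usual convention, complete and edgeless graphs do not count as strongly regular.
\<close>

definition strongly_regular_graph ::
    "'a set \<Rightarrow> ('a \<Rightarrow> 'a \<Rightarrow> bool) \<Rightarrow> nat \<Rightarrow> nat \<Rightarrow> nat \<Rightarrow> nat \<Rightarrow> bool" where
  "strongly_regular_graph V adj v d lam mu \<longleftrightarrow>
     finite V \<and> card V = v \<and>
     (\<forall>x\<in>V. \<not> adj x x) \<and> (\<forall>x\<in>V. \<forall>y\<in>V. adj x y \<longrightarrow> adj y x) \<and>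
     (\<exists>x\<in>V. \<exists>y\<in>V. adj x y) \<and> (\<exists>x\<in>V. \<exists>y\<in>V. x \<noteq> y \<and> \<not> adj x y) \<and>
     (\<forall>x\<in>V. card {z \<in> V. adj x z} = d) \<and>
     (\<forall>x\<in>V. \<forall>y\<in>V. adj x y \<longrightarrow> card {z \<in> V. adj x z \<and> adj y z} = lam) \<and>
     (\<forall>x\<in>V. \<forall>y\<in>V. x \<noteq> y \<and> \<not> adj x y \<longrightarrow> card {z \<in> V. adj x z \<and> adj y z} = mu)"

definition strongly_regular_configuration ::
    "('p, 'l) incidence_structure \<Rightarrow> nat \<Rightarrow> nat \<Rightarrow> nat \<Rightarrow> nat \<Rightarrow> bool" where
  "strongly_regular_configuration S v k lam mu \<longleftrightarrow>
     symmetric_configuration S v k \<and>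
     strongly_regular_graph (points S) (point_adj S) v (k * (k - 1)) lam mu"

definition alpha_beta_geometry ::
    "('p, 'l) incidence_structure \<Rightarrow> nat \<Rightarrow> nat \<Rightarrow> bool" where
  "alpha_beta_geometry S \<alpha> \<beta> \<longleftrightarrow>
     (\<exists>v k. symmetric_configuration S v k) \<and>
     (\<forall>P\<in>points S. \<forall>l\<in>lines S. \<not> inc S P l \<longrightarrow>
        card {Q \<in> points_on S l. point_adj S P Q} \<in> {\<alpha>, \<beta>})"

end

theory Submission
  imports Defs
begin

text \<open>
  The remaining points form a 3-net of order \<open>m = n - 1\<close>: its three parallel classes are the
  remaining parts of the lines through \<open>A\<close>, through \<open>B\<close> and through \<open>C\<close>, and two
  points are adjacent iff they agree in none of the three coordinates. A point each of whose three
  coordinates is that of \<open>x\<close> or that of \<open>y\<close> shares two coordinates with one of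
  them and hence equals it, so inclusion-exclusion over the three coordinates yields the degree,
  \<open>\<lambda>\<close> and \<open>\<mu>\<close> at once.

  A remaining line misses exactly one member \<open>p\<close>, \<open>q\<close>, \<open>r\<close> of each class. A point \<open>P\<close> off
  the line is collinear with \<open>n - 5 + j\<close> of its points, where \<open>j\<close> counts the members
  among \<open>p\<close>, \<open>q\<close>, \<open>r\<close> through \<open>P\<close>; here \<open>j = 0\<close>, \<open>j = 1\<close> and some \<open>j \<ge> 2\<close> all occur.
\<close>

section \<open>Three-nets\<close>

text \<open>The bijection onto the full product restricts to one from the counted set onto the
  subproduct \<open>F \<times> G\<close>.\<close>

lemma card_preimage_pair:
  assumes "bij_betw (\<lambda>z. (a z, b z)) U (P \<times> Q)" "F \<subseteq> P" "G \<subseteq> Q"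
  shows "card {z \<in> U. a z \<in> F \<and> b z \<in> G} = card F * card G"
proof -
  have "(\<lambda>z. (a z, b z)) ` {z \<in> U. a z \<in> F \<and> b z \<in> G} = (P \<times> Q) \<inter> (F \<times> G)"
    unfolding bij_betw_imp_surj_on[OF assms(1), symmetric] by auto
  also have "\<dots> = F \<times> G" using assms(2,3) by auto
  finally have "bij_betw (\<lambda>z. (a z, b z)) {z \<in> U. a z \<in> F \<and> b z \<in> G} (F \<times> G)"
    by (intro bij_betw_subset[OF assms(1)]) auto
  then show ?thesis
    by (simp add: bij_betw_same_card card_cartesian_product)
qed

text \<open>Each point is coded by the member of each parallel class through it. Members of
  different classes meet in exactly one point, which is what the three bijections say. Since
  \<open>card\<close> of an infinite set is 0, \<open>m_pos\<close> forces the classes to be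
  finite.\<close>

locale three_net =
  fixes V :: "'v set" and X :: "'x set" and Y :: "'y set" and Z :: "'z set"
    and f :: "'v \<Rightarrow> 'x" and g :: "'v \<Rightarrow> 'y" and h :: "'v \<Rightarrow> 'z" and m :: nat
  assumes bij_fg: "bij_betw (\<lambda>z. (f z, g z)) V (X \<times> Y)"
    and bij_fh: "bij_betw (\<lambda>z. (f z, h z)) V (X \<times> Z)"
    and bij_gh: "bij_betw (\<lambda>z. (g z, h z)) V (Y \<times> Z)"
    and card_X: "card X = m" and card_Y: "card Y = m" and card_Z: "card Z = m"
    and m_pos: "m > 0"
begin

definition adj :: "'v \<Rightarrow> 'v \<Rightarrow> bool" where
  "adj x y \<longleftrightarrow> f x \<noteq> f y \<and> g x \<noteq> g y \<and> h x \<noteq> h y"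

lemma finite_classes: "finite X" "finite Y" "finite Z"
  using card_X card_Y card_Z m_pos by (simp_all add: card_ge_0_finite)

lemma finite_V: "finite V"
  using bij_betw_finite[OF bij_fg] finite_classes by simp

lemma card_V: "card V = m ^ 2"
  using bij_betw_same_card[OF bij_fg]
  by (simp add: card_cartesian_product card_X card_Y power2_eq_square)

lemma range_X: "z \<in> V \<Longrightarrow> f z \<in> X" and range_Y: "z \<in> V \<Longrightarrow> g z \<in> Y"
  and range_Z: "z \<in> V \<Longrightarrow> h z \<in> Z"
  using bij_betwE[OF bij_fg] bij_betwE[OF bij_fh] by auto

lemma eq_fg: "\<lbrakk>x \<in> V; y \<in> V; f x = f y; g x = g y\<rbrakk> \<Longrightarrow> x = y"
  using bij_fg by (auto simp: bij_betw_def inj_on_def)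

lemma eq_fh: "\<lbrakk>x \<in> V; y \<in> V; f x = f y; h x = h y\<rbrakk> \<Longrightarrow> x = y"
  using bij_fh by (auto simp: bij_betw_def inj_on_def)

lemma eq_gh: "\<lbrakk>x \<in> V; y \<in> V; g x = g y; h x = h y\<rbrakk> \<Longrightarrow> x = y"
  using bij_gh by (auto simp: bij_betw_def inj_on_def)

lemma card_fg: "\<lbrakk>F \<subseteq> X; G \<subseteq> Y\<rbrakk> \<Longrightarrow> card {z \<in> V. f z \<in> F \<and> g z \<in> G} = card F * card G"
  by (rule card_preimage_pair[OF bij_fg])

lemma card_fh: "\<lbrakk>F \<subseteq> X; H \<subseteq> Z\<rbrakk> \<Longrightarrow> card {z \<in> V. f z \<in> F \<and> h z \<in> H} = card F * card H"
  by (rule card_preimage_pair[OF bij_fh])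

lemma card_gh: "\<lbrakk>G \<subseteq> Y; H \<subseteq> Z\<rbrakk> \<Longrightarrow> card {z \<in> V. g z \<in> G \<and> h z \<in> H} = card G * card H"
  by (rule card_preimage_pair[OF bij_gh])

text \<open>Letting the second coordinate range over a whole class of size \<open>m\<close> turns
  the count for pairs into one for a single coordinate.\<close>

lemma card_f: "F \<subseteq> X \<Longrightarrow> card {z \<in> V. f z \<in> F} = card F * m"
  using card_fg[of F Y] range_Y by (simp add: card_Y cong: conj_cong)

lemma card_g: "G \<subseteq> Y \<Longrightarrow> card {z \<in> V. g z \<in> G} = card G * m"
  using card_fg[of X G] range_X by (simp add: card_X mult.commute cong: conj_cong)

lemma card_h: "H \<subseteq> Z \<Longrightarrow> card {z \<in> V. h z \<in> H} = card H * m"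
  using card_fh[of X H] range_X by (simp add: card_X mult.commute cong: conj_cong)

section \<open>Inclusion-exclusion and strong regularity of the net graph\<close>

text \<open>Single and pairwise intersections are determined by the net axioms, so
  inclusion-exclusion leaves only the triple intersection as an unknown. Working in
  \<open>int\<close> avoids truncated subtraction.\<close>

lemma card_avoiding:
  assumes "F \<subseteq> X" "G \<subseteq> Y" "H \<subseteq> Z"
  shows "int (card {z \<in> V. f z \<notin> F \<and> g z \<notin> G \<and> h z \<notin> H}) =
    (int m)\<^sup>2 - (int (card F) + int (card G) + int (card H)) * int m
    + int (card F) * int (card G) + int (card F) * int (card H) + int (card G) * int (card H)
    - int (card {z \<in> V. f z \<in> F \<and> g z \<in> G \<and> h z \<in> H})"
proof -
  have count: "int (card {z \<in> V. P z}) = (\<Sum>z\<in>V. if P z then 1 else 0)" for P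
    using finite_V by (simp add: sum.If_cases Int_def)
  \<comment> \<open>Pointwise this is the expansion of (1 - a)(1 - b)(1 - c) for the indicators a,
    b, c of the three memberships.\<close>
  have "int (card {z \<in> V. f z \<notin> F \<and> g z \<notin> G \<and> h z \<notin> H}) =
     (\<Sum>z\<in>V. 1 - (if f z \<in> F then 1 else 0) - (if g z \<in> G then 1 else 0)
        - (if h z \<in> H then 1 else 0)
        + (if f z \<in> F \<and> g z \<in> G then 1 else 0) + (if f z \<in> F \<and> h z \<in> H then 1 else 0)
        + (if g z \<in> G \<and> h z \<in> H then 1 else 0)
        - (if f z \<in> F \<and> g z \<in> G \<and> h z \<in> H then 1 else 0))"
    unfolding count by (rule sum.cong) auto
  also have "\<dots> = int (card V) - int (card {z \<in> V. f z \<in> F}) - int (card {z \<in> V. g z \<in> G})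
      - int (card {z \<in> V. h z \<in> H})
      + int (card {z \<in> V. f z \<in> F \<and> g z \<in> G}) + int (card {z \<in> V. f z \<in> F \<and> h z \<in> H})
      + int (card {z \<in> V. g z \<in> G \<and> h z \<in> H})
      - int (card {z \<in> V. f z \<in> F \<and> g z \<in> G \<and> h z \<in> H})"
    unfolding count by (simp add: sum.distrib sum_subtractf)
  finally show ?thesis
    by (simp add: card_V card_f[OF assms(1)] card_g[OF assms(2)] card_h[OF assms(3)]
        card_fg[OF assms(1,2)] card_fh[OF assms(1,3)] card_gh[OF assms(2,3)] distrib_right)
qed

text \<open>Pigeonhole: of the three coordinates of \<open>z\<close>, two come from the same point,
  \<open>x\<close> or \<open>y\<close>, and two coordinates determine a point.\<close>

lemma agreeing_with_two_points:
  assumes "x \<in> V" "y \<in> V"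
  shows "{z \<in> V. f z \<in> {f x, f y} \<and> g z \<in> {g x, g y} \<and> h z \<in> {h x, h y}} = {x, y}"
proof (intro set_eqI iffI)
  fix z assume "z \<in> {z \<in> V. f z \<in> {f x, f y} \<and> g z \<in> {g x, g y} \<and> h z \<in> {h x, h y}}"
  then show "z \<in> {x, y}"
    using eq_fg[of z x] eq_fh[of z x] eq_gh[of z x] eq_fg[of z y] eq_fh[of z y] eq_gh[of z y]
      assms by blast
qed (use assms in auto)

text \<open>Each of \<open>a\<close>, \<open>b\<close>, \<open>c\<close> is 1 or 2 according to
  whether \<open>x\<close> and \<open>y\<close> agree in that coordinate, so one formula covers
  equal, adjacent and non-adjacent pairs.\<close>

lemma card_common_neighbours:
  assumes "x \<in> V" "y \<in> V"
  shows "int (card {z \<in> V. adj x z \<and> adj y z}) =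
    (let a = int (card {f x, f y}); b = int (card {g x, g y}); c = int (card {h x, h y})
     in (int m)\<^sup>2 - (a + b + c) * int m + a * b + a * c + b * c - int (card {x, y}))"
proof -
  have "{z \<in> V. adj x z \<and> adj y z} =
      {z \<in> V. f z \<notin> {f x, f y} \<and> g z \<notin> {g x, g y} \<and> h z \<notin> {h x, h y}}"
    by (auto simp: adj_def)
  then show ?thesis
    using card_avoiding[of "{f x, f y}" "{g x, g y}" "{h x, h y}"] assms
    by (simp only: agreeing_with_two_points range_X range_Y range_Z Let_def insert_subset
        empty_subsetI simp_thms)
qed

lemma degree:
  assumes "x \<in> V" "m \<ge> 2"
  shows "card {z \<in> V. adj x z} = (m - 1) * (m - 2)"
proof -
  \<comment> \<open>Substituting \<open>k + 2\<close> for \<open>m\<close> removes truncated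
    subtraction. The formula is then used with \<open>y = x\<close>, where
    \<open>a = b = c = 1\<close>.\<close>
  obtain k where k: "m = k + 2" using assms(2) by (metis le_add_diff_inverse2)
  have "int (card {z \<in> V. adj x z}) = int ((m - 1) * (m - 2))"
    using card_common_neighbours[OF assms(1,1)]
    by (simp add: k Let_def algebra_simps power2_eq_square)
  then show ?thesis by (simp only: of_nat_eq_iff)
qed

lemma common_neighbours_adj:
  assumes "x \<in> V" "y \<in> V" "adj x y" "m \<ge> 3"
  shows "card {z \<in> V. adj x z \<and> adj y z} = (m - 3)\<^sup>2 + 1"
proof -
  obtain k where k: "m = k + 3" using assms(4) by (metis le_add_diff_inverse2)
  have "x \<noteq> y" "f x \<noteq> f y" "g x \<noteq> g y" "h x \<noteq> h y" using assms by (auto simp: adj_def)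
  then have "int (card {z \<in> V. adj x z \<and> adj y z}) = int ((m - 3)\<^sup>2 + 1)"
    using card_common_neighbours[OF assms(1,2)]
    by (simp add: k Let_def algebra_simps power2_eq_square)
  then show ?thesis by (simp only: of_nat_eq_iff)
qed

lemma common_neighbours_nonadj:
  assumes "x \<in> V" "y \<in> V" "x \<noteq> y" "\<not> adj x y" "m \<ge> 3"
  shows "card {z \<in> V. adj x z \<and> adj y z} = (m - 2) * (m - 3)"
proof -
  obtain k where k: "m = k + 3" using assms(5) by (metis le_add_diff_inverse2)
  \<comment> \<open>Non-adjacency gives an agreement in at least one coordinate, and distinctness
    allows at most one. Hence one of \<open>a\<close>, \<open>b\<close>, \<open>c\<close> is 1 and
    the other two are 2.\<close>
  consider "f x = f y" "g x \<noteq> g y" "h x \<noteq> h y" | "f x \<noteq> f y" "g x = g y" "h x \<noteq> h y"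
    | "f x \<noteq> f y" "g x \<noteq> g y" "h x = h y"
    using assms eq_fg eq_fh eq_gh unfolding adj_def by blast
  then have "int (card {z \<in> V. adj x z \<and> adj y z}) = int ((m - 2) * (m - 3))"
    using card_common_neighbours[OF assms(1,2)] assms(3)
    by cases (simp_all add: k Let_def algebra_simps power2_eq_square)
  then show ?thesis by (simp only: of_nat_eq_iff)
qed

text \<open>Beyond the three counts, the graph must be neither edgeless nor complete: the degree is
  positive, and the \<open>m\<close> points sharing the first coordinate of \<open>x\<close> include
  one other than \<open>x\<close>.\<close>

lemma strongly_regular:
  assumes "m \<ge> 3"
  shows "strongly_regular_graph V adj (m\<^sup>2) ((m - 1) * (m - 2)) ((m - 3)\<^sup>2 + 1) ((m - 2) * (m - 3))"
proof -
  have "V \<noteq> {}" using card_V m_pos by auto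
  then obtain x where x: "x \<in> V" by blast
  have "{z \<in> V. adj x z} \<noteq> {}"
  proof
    assume "{z \<in> V. adj x z} = {}"
    then have "card {z \<in> V. adj x z} = 0" by (simp only: card.empty)
    then have "(m - 1) * (m - 2) = 0" using degree[OF x] assms by linarith
    then show False using assms by auto
  qed
  moreover have "\<exists>y\<in>V. x \<noteq> y \<and> \<not> adj x y"
  proof -
    have "card {z \<in> V. f z \<in> {f x}} = m" using card_f[of "{f x}"] range_X x by simp
    then have "\<not> {z \<in> V. f z \<in> {f x}} \<subseteq> {x}"
      using assms card_mono[of "{x}" "{z \<in> V. f z \<in> {f x}}"] by auto
    then show ?thesis unfolding adj_def by auto
  qed
  ultimately show ?thesis
    unfolding strongly_regular_graph_def
    using finite_V card_V x assms degree common_neighbours_adj common_neighbours_nonadj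
    by (auto simp: adj_def)
qed

section \<open>Neighbours on a transversal\<close>

text \<open>\<open>W\<close> meets every member of the classes once, except the missed members
  \<open>p\<close>, \<open>q\<close>, \<open>r\<close>. Of its \<open>m - 1\<close> points, each
  coordinate of \<open>P\<close> excludes exactly one, or none if that coordinate is the missed
  member.\<close>

lemma card_neighbours_on_transversal:
  assumes W: "W \<subseteq> V" "bij_betw f W (X - {p})" "bij_betw g W (Y - {q})" "bij_betw h W (Z - {r})"
    and p: "p \<in> X" and P: "P \<in> V" "P \<notin> W"
  shows "int (card {Q \<in> W. adj P Q}) =
    int m - 4 + of_bool (f P = p) + of_bool (g P = q) + of_bool (h P = r)"
proof -
  have fin: "finite W" using W(1) finite_V finite_subset by blast
  have hit: "card {Q \<in> W. a Q = a P} = of_bool (a P \<noteq> s)"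
    if "bij_betw a W (K - {s})" "a P \<in> K" for a :: "'v \<Rightarrow> 'c" and K s
  proof (cases "a P = s")
    case True
    then have none: "{Q \<in> W. a Q = a P} = {}" using bij_betwE[OF that(1)] by auto
    show ?thesis unfolding none using True by simp
  next
    case False
    then have "a P \<in> a ` W" using that bij_betw_imp_surj_on[OF that(1)] by simp
    then obtain Q where "Q \<in> W" "a Q = a P" by (metis imageE)
    then have "{Q \<in> W. a Q = a P} = {Q}"
      using that(1) unfolding bij_betw_def inj_on_def by auto
    then show ?thesis using False by simp
  qed
  have count: "int (card {Q \<in> W. R Q}) = (\<Sum>Q\<in>W. if R Q then 1 else 0)" for R
    using fin by (simp add: sum.If_cases Int_def)
  \<comment> \<open>A point of \<open>W\<close> agreeing with \<open>P\<close> twice would be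
    \<open>P\<close>, which lies off \<open>W\<close>. So the excluded points are different and no
    correction terms arise.\<close>
  have once: "\<not> (f Q = f P \<and> g Q = g P)" "\<not> (f Q = f P \<and> h Q = h P)"
      "\<not> (g Q = g P \<and> h Q = h P)" if "Q \<in> W" for Q
    using that W(1) P eq_fg[of Q P] eq_fh[of Q P] eq_gh[of Q P] by auto
  have "int (card {Q \<in> W. adj P Q}) = (\<Sum>Q\<in>W. 1 - (if f Q = f P then 1 else 0)
      - (if g Q = g P then 1 else 0) - (if h Q = h P then 1 else 0))"
    unfolding count
  proof (rule sum.cong[OF refl])
    fix Q assume "Q \<in> W"
    then show "(if adj P Q then 1 else 0) = 1 - (if f Q = f P then 1 else 0)
        - (if g Q = g P then 1 else 0) - (if h Q = h P then 1 else (0::int))"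
      using once[of Q] by (auto simp: adj_def)
  qed
  also have "\<dots> = int (card W) - int (card {Q \<in> W. f Q = f P}) - int (card {Q \<in> W. g Q = g P})
      - int (card {Q \<in> W. h Q = h P})"
    unfolding count by (simp add: sum_subtractf)
  also have "\<dots> = int (card W) - of_bool (f P \<noteq> p) - of_bool (g P \<noteq> q) - of_bool (h P \<noteq> r)"
    using hit[OF W(2) range_X[OF P(1)]] hit[OF W(3) range_Y[OF P(1)]] hit[OF W(4) range_Z[OF P(1)]]
    by simp
  also have "int (card W) = int m - 1"
    using bij_betw_same_card[OF W(2)] p card_X m_pos by (simp add: of_nat_diff)
  finally show ?thesis by (auto simp: of_bool_def)
qed

lemma transversal_neighbour_counts:
  assumes W: "W \<subseteq> V" "bij_betw f W (X - {p})" "bij_betw g W (Y - {q})" "bij_betw h W (Z - {r})"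
    and pqr: "p \<in> X" "q \<in> Y" "r \<in> Z" and m: "m \<ge> 4"
  shows "\<not> (\<forall>P\<in>V - W. card {Q \<in> W. adj P Q} \<in> {\<alpha>, \<beta>})"
proof -
  note counts = card_neighbours_on_transversal[OF W pqr(1)]
  have off: "f Q \<noteq> p" "g Q \<noteq> q" "h Q \<noteq> r" if "Q \<in> W" for Q
    using bij_betwE[OF W(2)] bij_betwE[OF W(3)] bij_betwE[OF W(4)] that by auto
  \<comment> \<open>\<open>P2\<close> is where the missed members \<open>p\<close> and
    \<open>q\<close> meet. It may also lie on \<open>r\<close>, hence only a lower bound for its
    count below.\<close>
  have "card {z \<in> V. f z \<in> {p} \<and> g z \<in> {q}} = 1"
    using card_fg[of "{p}" "{q}"] pqr by simp
  then obtain P2 where P2: "P2 \<in> V" "f P2 = p" "g P2 = q"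
    by (auto simp: card_1_singleton_iff)
  \<comment> \<open>On \<open>p\<close>, at most two points lie on \<open>q\<close> or
    \<open>r\<close>; since \<open>p\<close> has \<open>m\<close> points, some \<open>P1\<close>
    lies on \<open>p\<close> alone.\<close>
  have "card ({z \<in> V. f z \<in> {p} \<and> g z \<in> {q}} \<union> {z \<in> V. f z \<in> {p} \<and> h z \<in> {r}}) \<le> 2"
    using card_Un_le[of "{z \<in> V. f z \<in> {p} \<and> g z \<in> {q}}" "{z \<in> V. f z \<in> {p} \<and> h z \<in> {r}}"]
      card_fg[of "{p}" "{q}"] card_fh[of "{p}" "{r}"] pqr by simp
  moreover have "card {z \<in> V. f z \<in> {p}} = m" using card_f[of "{p}"] pqr by simp
  ultimately have "\<not> {z \<in> V. f z \<in> {p}}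
      \<subseteq> {z \<in> V. f z \<in> {p} \<and> g z \<in> {q}} \<union> {z \<in> V. f z \<in> {p} \<and> h z \<in> {r}}"
    using m finite_V
      card_mono[of "{z \<in> V. f z \<in> {p} \<and> g z \<in> {q}} \<union> {z \<in> V. f z \<in> {p} \<and> h z \<in> {r}}"
        "{z \<in> V. f z \<in> {p}}"] by fastforce
  then obtain P1 where P1: "P1 \<in> V" "f P1 = p" "g P1 \<noteq> q" "h P1 \<noteq> r" by blast
  \<comment> \<open>\<open>W\<close> and the three missed members cover at most
    \<open>4 * m - 1\<close> points, fewer than \<open>m * m\<close> because
    \<open>m \<ge> 4\<close>. This leaves \<open>P0\<close> off all of them.\<close>
  have "card (W \<union> {z \<in> V. f z \<in> {p}} \<union> {z \<in> V. g z \<in> {q}} \<union> {z \<in> V. h z \<in> {r}}) \<le>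
      card W + card {z \<in> V. f z \<in> {p}} + card {z \<in> V. g z \<in> {q}} + card {z \<in> V. h z \<in> {r}}"
    by (meson card_Un_le add_mono le_trans order_refl)
  also have "\<dots> = (m - 1) + 3 * m"
    using card_f[of "{p}"] card_g[of "{q}"] card_h[of "{r}"] pqr
      bij_betw_same_card[OF W(2)] card_X by simp
  also have "\<dots> < m * m"
    using m mult_le_mono1[OF m, of m] by linarith
  finally have "\<not> V \<subseteq> W \<union> {z \<in> V. f z \<in> {p}} \<union> {z \<in> V. g z \<in> {q}} \<union> {z \<in> V. h z \<in> {r}}"
    using card_mono[of "W \<union> {z \<in> V. f z \<in> {p}} \<union> {z \<in> V. g z \<in> {q}} \<union> {z \<in> V. h z \<in> {r}}" V]
      finite_V finite_subset[OF W(1)] card_V by (auto simp: power2_eq_square)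
  then obtain P0 where P0: "P0 \<in> V" "P0 \<notin> W" "f P0 \<noteq> p" "g P0 \<noteq> q" "h P0 \<noteq> r" by blast
  have outside: "P1 \<notin> W" "P2 \<notin> W" using P1 P2 off by auto
  have "int (card {Q \<in> W. adj P0 Q}) = int m - 4" "int (card {Q \<in> W. adj P1 Q}) = int m - 3"
    "int (card {Q \<in> W. adj P2 Q}) \<ge> int m - 2"
    using counts[of P0] counts[of P1] counts[of P2] P0 P1 P2 outside by auto
  then have "distinct [card {Q \<in> W. adj P0 Q}, card {Q \<in> W. adj P1 Q}, card {Q \<in> W. adj P2 Q}]"
    by auto
  moreover have "P0 \<in> V - W" "P1 \<in> V - W" "P2 \<in> V - W"
    using P0 P1 P2 outside by auto
  ultimately show ?thesis
    by (metis (no_types, lifting) distinct_length_2_or_more empty_iff insert_iff)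
qed

end

text \<open>Serves to pass from the net relation \<open>adj\<close> to \<open>point_adj\<close>, as
  the two are compared only on the vertex set.\<close>

lemma strongly_regular_graph_cong:
  assumes "\<And>x y. \<lbrakk>x \<in> V; y \<in> V\<rbrakk> \<Longrightarrow> R x y \<longleftrightarrow> R' x y"
  shows "strongly_regular_graph V R v d lam mu \<longleftrightarrow> strongly_regular_graph V R' v d lam mu"
proof -
  have "{z \<in> V. R x z} = {z \<in> V. R' x z}" if "x \<in> V" for x using assms that by auto
  moreover have "{z \<in> V. R x z \<and> R y z} = {z \<in> V. R' x z \<and> R' y z}" if "x \<in> V" "y \<in> V" for x y
    using assms that by auto
  ultimately show ?thesis
    unfolding strongly_regular_graph_def by (simp add: assms cong: ball_cong bex_cong)
qed

section \<open>Projective planes of order \<open>n\<close>\<close>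

locale plane_of_order =
  fixes S :: "('p, 'l) incidence_structure" and n :: nat
  assumes plane: "projective_plane_of_order S n"
begin

lemma ex1_line: "\<lbrakk>P \<in> points S; Q \<in> points S; P \<noteq> Q\<rbrakk> \<Longrightarrow>
    \<exists>!l. l \<in> lines S \<and> inc S P l \<and> inc S Q l"
  using plane unfolding projective_plane_of_order_def projective_plane_def by blast

lemma ex_meet: "\<lbrakk>l \<in> lines S; k \<in> lines S\<rbrakk> \<Longrightarrow> l \<noteq> k \<Longrightarrow> \<exists>P\<in>points S. inc S P l \<and> inc S P k"
  using plane unfolding projective_plane_of_order_def projective_plane_def by blast

lemma card_points_on: "l \<in> lines S \<Longrightarrow> card (points_on S l) = n + 1"
  using plane unfolding projective_plane_of_order_def by blast

lemma finite_points_on: "l \<in> lines S \<Longrightarrow> finite (points_on S l)"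
  using card_points_on by (simp add: card_ge_0_finite)

lemma join_line:
  assumes "P \<in> points S" "Q \<in> points S" "P \<noteq> Q"
  shows "join S P Q \<in> lines S" "inc S P (join S P Q)" "inc S Q (join S P Q)"
  using theI'[OF ex1_line[OF assms]] unfolding join_def by auto

lemma line_unique: "\<lbrakk>P \<in> points S; Q \<in> points S; P \<noteq> Q; l \<in> lines S; k \<in> lines S;
    inc S P l; inc S Q l; inc S P k; inc S Q k\<rbrakk> \<Longrightarrow> l = k"
  using ex1_line by blast

lemma join_eq: "\<lbrakk>P \<in> points S; Q \<in> points S; P \<noteq> Q; l \<in> lines S; inc S P l; inc S Q l\<rbrakk> \<Longrightarrow>
    join S P Q = l"
  using line_unique join_line by metis

lemma join_commute: "join S P Q = join S Q P"
  unfolding join_def by (simp add: conj_commute)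

text \<open>Perspectivity from \<open>P\<close>: each line through \<open>P\<close> meets
  \<open>l\<close> in exactly one point, so joining with \<open>P\<close> maps the points of
  \<open>l\<close> bijectively onto the pencil.\<close>

lemma card_lines_through:
  assumes "P \<in> points S" "l \<in> lines S" "\<not> inc S P l"
  shows "card (lines_through S P) = n + 1"
proof -
  have "bij_betw (join S P) (points_on S l) (lines_through S P)"
    unfolding bij_betw_def
  proof
    show "inj_on (join S P) (points_on S l)"
    proof (rule inj_onI)
      fix Q R assume QR: "Q \<in> points_on S l" "R \<in> points_on S l" "join S P Q = join S P R"
      then have "P \<noteq> Q" "P \<noteq> R" using assms unfolding points_on_def by auto
      then show "Q = R"
        using line_unique[of Q R l "join S P Q"] join_line[of P Q] join_line[of P R] QR assms
        unfolding points_on_def by auto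
    qed
    show "join S P ` points_on S l = lines_through S P"
    proof
      show "join S P ` points_on S l \<subseteq> lines_through S P"
        using join_line assms unfolding points_on_def lines_through_def by auto
      show "lines_through S P \<subseteq> join S P ` points_on S l"
      proof
        fix k assume k: "k \<in> lines_through S P"
        then obtain Q where "Q \<in> points S" "inc S Q l" "inc S Q k"
          using ex_meet[of l k] assms unfolding lines_through_def by auto
        then show "k \<in> join S P ` points_on S l"
          using join_eq[of P Q k] k assms unfolding lines_through_def points_on_def by force
      qed
    qed
  qed
  then show ?thesis using card_points_on assms bij_betw_same_card by metis
qed

section \<open>The net of remaining points\<close>

definition remaining_points :: "'p \<Rightarrow> 'p \<Rightarrow> 'p \<Rightarrow> 'p set" where
  "remaining_points A B C = {P \<in> points S. \<not> inc S P (join S A B) \<and> \<not> inc S P (join S A C) \<and>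
                              \<not> inc S P (join S B C)}"

text \<open>The parallel class belonging to the first vertex. The other two classes arise by
  permuting the arguments.\<close>

definition remaining_pencil :: "'p \<Rightarrow> 'p \<Rightarrow> 'p \<Rightarrow> 'l set" where
  "remaining_pencil A B C = lines_through S A - {join S A B, join S A C}"

text \<open>These transpositions, together with \<open>triangle_swap\<close>, let facts proved at
  vertex \<open>A\<close> be reused at \<open>B\<close> and \<open>C\<close>.\<close>

lemma remaining_points_swap:
  "remaining_points A C B = remaining_points A B C"
  "remaining_points B A C = remaining_points A B C"
  unfolding remaining_points_def by (auto simp: join_commute[of B A] join_commute[of C B])

lemma remaining_pencil_swap: "remaining_pencil A C B = remaining_pencil A B C"
  unfolding remaining_pencil_def by auto

definition triangle :: "'p \<Rightarrow> 'p \<Rightarrow> 'p \<Rightarrow> bool" where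
  "triangle A B C \<longleftrightarrow> A \<in> points S \<and> B \<in> points S \<and> C \<in> points S \<and> A \<noteq> B \<and>
     \<not> inc S C (join S A B)"

text \<open>The definition is the short form to establish, this the symmetric form to use. A vertex
  on the opposite side would make two sides coincide.\<close>

lemma triangle_iff: "triangle A B C \<longleftrightarrow>
    A \<in> points S \<and> B \<in> points S \<and> C \<in> points S \<and>
    A \<noteq> B \<and> A \<noteq> C \<and> B \<noteq> C \<and>
    \<not> inc S C (join S A B) \<and> \<not> inc S B (join S A C) \<and> \<not> inc S A (join S B C)"
proof
  assume t: "triangle A B C"
  then have ne: "A \<in> points S" "B \<in> points S" "C \<in> points S" "A \<noteq> B" "A \<noteq> C" "B \<noteq> C"
      "\<not> inc S C (join S A B)"
    using join_line unfolding triangle_def by auto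
  then show "A \<in> points S \<and> B \<in> points S \<and> C \<in> points S \<and>
      A \<noteq> B \<and> A \<noteq> C \<and> B \<noteq> C \<and>
      \<not> inc S C (join S A B) \<and> \<not> inc S B (join S A C) \<and> \<not> inc S A (join S B C)"
    using join_eq[of A B "join S A C"] join_eq[of A B "join S B C"] join_line[of A C]
      join_line[of B C] by auto
qed (simp add: triangle_def)

lemma triangle_swap:
  assumes "triangle A B C" shows "triangle A C B" "triangle B A C"
  using assms by (auto simp: triangle_iff join_commute[of B A] join_commute[of C B])

lemma join_ne:
  assumes "triangle A B C" shows "join S A B \<noteq> join S A C"
  using assms join_line[of A C] by (auto simp: triangle_iff)

text \<open>No point lies on all three sides, since two sides through \<open>A\<close> meet only in
  \<open>A\<close> and \<open>A\<close> is off the third. So some side avoids \<open>P\<close>, and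
  the perspectivity count applies.\<close>

lemma card_pencil:
  assumes P: "P \<in> points S" and t: "triangle A B C"
  shows "card (lines_through S P) = n + 1"
proof -
  have "\<exists>l\<in>lines S. \<not> inc S P l"
  proof (rule ccontr)
    assume "\<not> ?thesis"
    then have on: "inc S P (join S A B)" "inc S P (join S A C)" "inc S P (join S B C)"
      using join_line t unfolding triangle_iff by auto
    have "P = A"
      using line_unique[OF P, of A "join S A B" "join S A C"] join_ne[OF t] on t join_line[of A B]
        join_line[of A C] unfolding triangle_iff by auto
    then show False using on t unfolding triangle_iff by auto
  qed
  then show ?thesis using card_lines_through P by blast
qed

lemma card_remaining_pencil:
  assumes "triangle A B C"
  shows "card (remaining_pencil A B C) = n - 1"
proof -
  have "{join S A B, join S A C} \<subseteq> lines_through S A"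
    using assms join_line unfolding triangle_iff lines_through_def by auto
  moreover have "card (lines_through S A) = n + 1" using card_pencil assms triangle_iff by blast
  ultimately show ?thesis
    using join_ne[OF assms] unfolding remaining_pencil_def
    by (subst card_Diff_subset) auto
qed

lemma remaining_ne_vertex:
  assumes "triangle A B C" "R \<in> remaining_points A B C"
  shows "R \<in> points S" "A \<noteq> R" "B \<noteq> R" "C \<noteq> R"
  using assms join_line unfolding triangle_iff remaining_points_def by auto

lemma join_vertex_remaining:
  assumes t: "triangle A B C" and R: "R \<in> remaining_points A B C"
  shows "join S A R \<in> remaining_pencil A B C"
  using assms remaining_ne_vertex[OF t R] join_line[of A R]
  unfolding remaining_pencil_def remaining_points_def lines_through_def triangle_iff by auto

text \<open>A remaining line through \<open>A\<close> and one through \<open>B\<close> meet in a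
  single point, and that point lies off all three sides.\<close>

lemma bij_remaining_points:
  assumes t: "triangle A B C"
  shows "bij_betw (\<lambda>R. (join S A R, join S B R)) (remaining_points A B C)
           (remaining_pencil A B C \<times> remaining_pencil B A C)"
  unfolding bij_betw_def
proof
  note t' = triangle_swap(2)[OF t]
  show "inj_on (\<lambda>R. (join S A R, join S B R)) (remaining_points A B C)"
  proof (rule inj_onI)
    fix Q R
    assume Q: "Q \<in> remaining_points A B C" and R: "R \<in> remaining_points A B C"
      and eq: "(join S A Q, join S B Q) = (join S A R, join S B R)"
    note ne = remaining_ne_vertex[OF t Q] remaining_ne_vertex[OF t R]
    have AB: "A \<in> points S" "B \<in> points S" "A \<noteq> B" using t triangle_iff by auto
    show "Q = R"
    proof (rule ccontr)
      assume "Q \<noteq> R"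
      \<comment> \<open>Both joins are the line through \<open>Q\<close> and \<open>R\<close>. It
        contains \<open>A\<close> and \<open>B\<close>, so it is the side \<open>join S A B\<close>,
        which \<open>Q\<close> avoids.\<close>
      then have "join S A Q = join S B Q"
        using line_unique[of Q R] join_line[of A Q] join_line[of A R] join_line[of B Q]
          join_line[of B R] eq ne AB by auto
      then have "join S A B = join S A Q"
        using join_eq[of A B "join S A Q"] join_line[of A Q] join_line[of B Q] ne AB by auto
      then show False using Q join_line[of A Q] ne AB unfolding remaining_points_def by auto
    qed
  qed
  show "(\<lambda>R. (join S A R, join S B R)) ` remaining_points A B C =
      remaining_pencil A B C \<times> remaining_pencil B A C"
  proof
    show "(\<lambda>R. (join S A R, join S B R)) ` remaining_points A B C \<subseteq>
        remaining_pencil A B C \<times> remaining_pencil B A C"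
      using join_vertex_remaining[OF t] join_vertex_remaining[OF t']
      by (auto simp: remaining_points_swap)
    show "remaining_pencil A B C \<times> remaining_pencil B A C \<subseteq>
        (\<lambda>R. (join S A R, join S B R)) ` remaining_points A B C"
    proof clarify
      fix l k assume l: "l \<in> remaining_pencil A B C" and k: "k \<in> remaining_pencil B A C"
      have ABC: "A \<in> points S" "B \<in> points S" "C \<in> points S" "A \<noteq> B" "A \<noteq> C" "B \<noteq> C"
        using t triangle_iff by auto
      have l': "l \<in> lines S" "inc S A l" "l \<noteq> join S A B" "l \<noteq> join S A C"
        and k': "k \<in> lines S" "inc S B k" "k \<noteq> join S A B" "k \<noteq> join S B C"
        using l k unfolding remaining_pencil_def lines_through_def
        by (auto simp: join_commute[of B A])
      have ne: "\<not> inc S B l" "\<not> inc S A k" "\<not> inc S C l" "\<not> inc S C k"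
        using join_eq ABC l' k' by blast+
      then obtain R where R: "R \<in> points S" "inc S R l" "inc S R k"
        using ex_meet[of l k] l' k' by auto
      have RAB: "A \<noteq> R" "B \<noteq> R" using R ne by auto
      \<comment> \<open>If \<open>R\<close> were on a side, that side would share a vertex and
        \<open>R\<close> with \<open>l\<close> or \<open>k\<close>, hence equal it.\<close>
      have "\<not> inc S R (join S A B)" "\<not> inc S R (join S A C)" "\<not> inc S R (join S B C)"
        using line_unique[of A R l "join S A B"] line_unique[of A R l "join S A C"]
          line_unique[of B R k "join S B C"] join_line[of A B] join_line[of A C] join_line[of B C]
          ABC R RAB l' k' by auto
      then have "R \<in> remaining_points A B C" using R unfolding remaining_points_def by auto
      moreover have "join S A R = l" "join S B R = k" using join_eq R RAB ABC l' k' by auto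
      ultimately show "(l, k) \<in> (\<lambda>R. (join S A R, join S B R)) ` remaining_points A B C"
        by force
    qed
  qed
qed

lemma three_net_triangle:
  assumes t: "triangle A B C" and "n \<ge> 2"
  shows "three_net (remaining_points A B C)
    (remaining_pencil A B C) (remaining_pencil B A C) (remaining_pencil C A B)
    (join S A) (join S B) (join S C) (n - 1)"
proof
  note s1 = triangle_swap(1)[OF t] and s2 = triangle_swap(2)[OF t]
  note s3 = triangle_swap(1)[OF s2] and s4 = triangle_swap(2)[OF s1]
  show "bij_betw (\<lambda>z. (join S A z, join S B z)) (remaining_points A B C)
      (remaining_pencil A B C \<times> remaining_pencil B A C)"
    by (rule bij_remaining_points[OF t])
  show "bij_betw (\<lambda>z. (join S A z, join S C z)) (remaining_points A B C)
      (remaining_pencil A B C \<times> remaining_pencil C A B)"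
    using bij_remaining_points[OF s1]
    by (simp only: remaining_points_swap(1) remaining_pencil_swap[of A B C])
  show "bij_betw (\<lambda>z. (join S B z, join S C z)) (remaining_points A B C)
      (remaining_pencil B A C \<times> remaining_pencil C A B)"
    using bij_remaining_points[OF s3] remaining_points_swap(1)[of B A C]
      remaining_points_swap(2)[of B A C] remaining_pencil_swap[of B A C]
      remaining_pencil_swap[of C A B] by simp
  show "card (remaining_pencil A B C) = n - 1" "card (remaining_pencil B A C) = n - 1"
    "card (remaining_pencil C A B) = n - 1" "n - 1 > 0"
    using card_remaining_pencil t s2 s4 \<open>n \<ge> 2\<close> by auto
qed

section \<open>The remaining lines as transversals\<close>

definition remaining_lines :: "'p \<Rightarrow> 'p \<Rightarrow> 'p \<Rightarrow> 'l set" where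
  "remaining_lines A B C = {l \<in> lines S. \<not> inc S A l \<and> \<not> inc S B l \<and> \<not> inc S C l}"

lemma ex1_meet: "\<lbrakk>l \<in> lines S; k \<in> lines S; l \<noteq> k\<rbrakk> \<Longrightarrow>
    \<exists>P. {Q \<in> points S. inc S Q l \<and> inc S Q k} = {P}"
  using plane unfolding projective_plane_of_order_def projective_plane_def by blast

text \<open>The line loses its three intersections with the sides. These differ, because two sides
  meet only in a vertex and \<open>l\<close> contains none.\<close>

lemma card_points_on_remaining_line:
  assumes t: "triangle A B C" and l: "l \<in> remaining_lines A B C"
  shows "card {P \<in> remaining_points A B C. inc S P l} = n - 2"
proof -
  have ABC: "A \<in> points S" "B \<in> points S" "C \<in> points S" "A \<noteq> B" "A \<noteq> C" "B \<noteq> C"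
    using t triangle_iff by auto
  have l': "l \<in> lines S" "\<not> inc S A l" "\<not> inc S B l" "\<not> inc S C l"
    using l unfolding remaining_lines_def by auto
  obtain D where D: "{Q \<in> points S. inc S Q l \<and> inc S Q (join S B C)} = {D}"
    using ex1_meet[of l "join S B C"] join_line[of B C] ABC l' by metis
  obtain E where E: "{Q \<in> points S. inc S Q l \<and> inc S Q (join S A C)} = {E}"
    using ex1_meet[of l "join S A C"] join_line[of A C] ABC l' by metis
  obtain F where F: "{Q \<in> points S. inc S Q l \<and> inc S Q (join S A B)} = {F}"
    using ex1_meet[of l "join S A B"] join_line[of A B] ABC l' by metis
  have on: "D \<in> points S" "inc S D l" "inc S D (join S B C)"
    "E \<in> points S" "inc S E l" "inc S E (join S A C)"
    "F \<in> points S" "inc S F l" "inc S F (join S A B)"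
    using D E F by blast+
  have "{P \<in> remaining_points A B C. inc S P l} = points_on S l - {D, E, F}"
    using D E F unfolding remaining_points_def points_on_def by blast
  moreover have "{D, E, F} \<subseteq> points_on S l" using on unfolding points_on_def by auto
  moreover have "D \<noteq> E"
    using line_unique[of C D "join S B C" "join S A C"] join_ne[OF triangle_swap(1)[OF
          triangle_swap(2)[OF triangle_swap(1)[OF t]]]] join_line[of B C] join_line[of A C] ABC on l'
    by (auto simp: join_commute[of C])
  moreover have "D \<noteq> F"
    using line_unique[of B D "join S B C" "join S A B"] join_ne[OF triangle_swap(2)[OF t]]
      join_line[of B C] join_line[of A B] ABC on l' by (auto simp: join_commute[of B A])
  moreover have "E \<noteq> F"
    using line_unique[of A E "join S A C" "join S A B"] join_ne[OF t]
      join_line[of A C] join_line[of A B] ABC on l' by auto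
  ultimately show ?thesis using card_points_on[OF l'(1)] by (simp add: card_Diff_subset)
qed

text \<open>Of the \<open>n + 1\<close> lines through \<open>P\<close>, exactly the joins with the
  vertices are deleted. They differ, since otherwise \<open>P\<close> would lie on a side.\<close>

lemma card_lines_through_remaining_point:
  assumes t: "triangle A B C" and P: "P \<in> remaining_points A B C"
  shows "card {l \<in> remaining_lines A B C. inc S P l} = n - 2"
proof -
  have ABC: "A \<in> points S" "B \<in> points S" "C \<in> points S" "A \<noteq> B" "A \<noteq> C" "B \<noteq> C"
    using t triangle_iff by auto
  note ne = remaining_ne_vertex[OF t P]
  have off: "\<not> inc S P (join S A B)" "\<not> inc S P (join S A C)" "\<not> inc S P (join S B C)"
    using P unfolding remaining_points_def by auto
  let ?T = "{join S A P, join S B P, join S C P}"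
  have "{l \<in> remaining_lines A B C. inc S P l} = lines_through S P - ?T"
    using join_line[of A P] join_line[of B P] join_line[of C P] join_eq[of A P] join_eq[of B P]
      join_eq[of C P] ABC ne
    unfolding remaining_lines_def lines_through_def by blast
  moreover have "?T \<subseteq> lines_through S P"
    using join_line[of A P] join_line[of B P] join_line[of C P] ABC ne
    unfolding lines_through_def by auto
  moreover have "join S A P \<noteq> join S B P" "join S A P \<noteq> join S C P" "join S B P \<noteq> join S C P"
    using join_eq[of A B "join S A P"] join_eq[of A C "join S A P"] join_eq[of B C "join S B P"]
      join_line[of A P] join_line[of B P] join_line[of C P] ABC ne off by auto
  ultimately show ?thesis using card_pencil[OF ne(1) t] by (simp add: card_Diff_subset)
qed

text \<open>The missed member is the join of \<open>A\<close> with the point \<open>D\<close> where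
  \<open>l\<close> meets the opposite side. This makes \<open>l\<close> a transversal of the
  net.\<close>

lemma bij_remaining_line:
  assumes t: "triangle A B C" and l: "l \<in> remaining_lines A B C" and "n \<ge> 2"
  shows "\<exists>p\<in>remaining_pencil A B C. bij_betw (join S A) {P \<in> remaining_points A B C. inc S P l}
           (remaining_pencil A B C - {p})"
proof -
  let ?W = "{P \<in> remaining_points A B C. inc S P l}"
  have ABC: "A \<in> points S" "B \<in> points S" "C \<in> points S" "A \<noteq> B" "A \<noteq> C" "B \<noteq> C"
      "\<not> inc S A (join S B C)"
    using t triangle_iff by auto
  have l': "l \<in> lines S" "\<not> inc S A l" "\<not> inc S B l" "\<not> inc S C l"
    using l unfolding remaining_lines_def by auto
  obtain D where D: "D \<in> points S" "inc S D l" "inc S D (join S B C)"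
    using ex_meet[of l "join S B C"] join_line[of B C] ABC l' by metis
  have ne: "A \<noteq> D" "B \<noteq> D" "C \<noteq> D" using D l' by auto
  have p: "join S A D \<in> remaining_pencil A B C"
  proof -
    have AD: "join S A D \<in> lines S" "inc S A (join S A D)" "inc S D (join S A D)"
      using join_line[of A D] ABC D ne by simp_all
    have BC: "join S B C \<in> lines S" "inc S B (join S B C)" "inc S C (join S B C)"
      using join_line[of B C] ABC by simp_all
    \<comment> \<open>Otherwise \<open>join S A D\<close> would share two points with
      \<open>join S B C\<close>, hence equal it and put \<open>A\<close> on it.\<close>
    have "\<not> inc S B (join S A D)" "\<not> inc S C (join S A D)"
      using line_unique[OF _ D(1) _ AD(1) BC(1)] AD BC ABC D(3) ne by metis+
    then show ?thesis
      using AD join_line(3)[of A B] join_line(3)[of A C] ABC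
      unfolding remaining_pencil_def lines_through_def by auto
  qed
  have inj: "inj_on (join S A) ?W"
  proof (rule inj_onI)
    fix Q R assume QR: "Q \<in> ?W" "R \<in> ?W" "join S A Q = join S A R"
    then show "Q = R"
      using remaining_ne_vertex[OF t, of Q] remaining_ne_vertex[OF t, of R] l' ABC(1)
        line_unique[of Q R l "join S A Q"] join_line[of A Q] join_line[of A R] by auto
  qed
  have "join S A Q \<noteq> join S A D" if "Q \<in> ?W" for Q
  proof
    assume "join S A Q = join S A D"
    moreover have "Q \<noteq> D" using that D unfolding remaining_points_def by auto
    ultimately show False
      using that remaining_ne_vertex[OF t, of Q] l' ABC(1) D ne(1)
        line_unique[of Q D l "join S A Q"] join_line[of A Q] join_line[of A D] by auto
  qed
  then have sub: "join S A ` ?W \<subseteq> remaining_pencil A B C - {join S A D}"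
    using join_vertex_remaining[OF t] by auto
  have card: "card (remaining_pencil A B C) = n - 1" by (rule card_remaining_pencil[OF t])
  then have fin: "finite (remaining_pencil A B C)" using \<open>n \<ge> 2\<close> by (simp add: card_ge_0_finite)
  \<comment> \<open>The inclusion is an equality by counting: both sides have \<open>n - 2\<close>
    elements.\<close>
  have "join S A ` ?W = remaining_pencil A B C - {join S A D}"
    using card_subset_eq[OF _ sub] fin card p card_image[OF inj]
      card_points_on_remaining_line[OF t l] by simp
  then show ?thesis using p inj unfolding bij_betw_def by blast
qed

text \<open>Every line contains a point of \<open>join S A B\<close>, so finitely many finite
  pencils cover all lines.\<close>

lemma finite_lines:
  assumes t: "triangle A B C" shows "finite (lines S)"
proof -
  have AB: "A \<in> points S" "B \<in> points S" "C \<in> points S" "A \<noteq> B" using t triangle_iff by auto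
  have "finite (lines_through S P)" if "P \<in> points S" for P
    using card_pencil[OF that t] by (simp add: card_ge_0_finite)
  then have "finite (\<Union>P\<in>points_on S (join S A B). lines_through S P)"
    using finite_points_on join_line AB unfolding points_on_def by auto
  moreover have "lines S \<subseteq> (\<Union>P\<in>points_on S (join S A B). lines_through S P)"
    using ex_meet[of _ "join S A B"] join_line[of A B] AB
    unfolding points_on_def lines_through_def by fastforce
  ultimately show ?thesis using finite_subset by blast
qed

text \<open>Double counting of flags: \<open>n - 2\<close> lines through each of the
  \<open>(n - 1)\<^sup>2\<close> points against \<open>n - 2\<close> points on each line. The common
  factor is positive as \<open>n \<ge> 3\<close>.\<close>

lemma card_remaining_lines:
  assumes t: "triangle A B C" and "n \<ge> 3"
  shows "card (remaining_lines A B C) = (n - 1)\<^sup>2"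
proof -
  interpret three_net "remaining_points A B C" "remaining_pencil A B C" "remaining_pencil B A C"
    "remaining_pencil C A B" "join S A" "join S B" "join S C" "n - 1"
    using three_net_triangle[OF t] \<open>n \<ge> 3\<close> by simp
  have "finite (remaining_lines A B C)"
    using finite_lines[OF t] unfolding remaining_lines_def by simp
  then have "(\<Sum>P\<in>remaining_points A B C. card {l \<in> remaining_lines A B C. inc S P l})
      = (n - 2) * card (remaining_lines A B C)"
    using card_points_on_remaining_line[OF t]
    by (intro sum_multicount) (use finite_V in auto)
  moreover have "(\<Sum>P\<in>remaining_points A B C. card {l \<in> remaining_lines A B C. inc S P l})
      = (n - 2) * (n - 1)\<^sup>2"
    using card_lines_through_remaining_point[OF t] by (simp add: card_V)
  ultimately have "(n - 2) * card (remaining_lines A B C) = (n - 2) * (n - 1)\<^sup>2" by (rule trans[OF sym])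
  moreover have "n - 2 > 0" using \<open>n \<ge> 3\<close> by simp
  ultimately show ?thesis by (metis mult_cancel1 less_irrefl)
qed

section \<open>Adjacency in the configuration and the final assembly\<close>

text \<open>Distinct \<open>P\<close> and \<open>Q\<close> agree in the coordinate of a vertex iff
  their join passes through it, and the join survives deletion iff it avoids all three
  vertices.\<close>

lemma point_adj_delete_triangle:
  assumes t: "triangle A B C"
    and P: "P \<in> remaining_points A B C" and Q: "Q \<in> remaining_points A B C"
  shows "point_adj (delete_triangle S A B C) P Q \<longleftrightarrow>
    join S A P \<noteq> join S A Q \<and> join S B P \<noteq> join S B Q \<and> join S C P \<noteq> join S C Q"
proof (cases "P = Q")
  case True
  then show ?thesis by (simp add: point_adj_def)
next
  case False
  note ne = remaining_ne_vertex[OF t P] remaining_ne_vertex[OF t Q]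
  have ABC: "A \<in> points S" "B \<in> points S" "C \<in> points S" using t triangle_iff by auto
  have through: "join S X P = join S X Q \<longleftrightarrow> inc S X (join S P Q)"
    if "X \<in> points S" "X \<noteq> P" "X \<noteq> Q" for X
    using that ne False join_line[of X P] join_line[of X Q] join_line[of P Q]
      join_eq[of P Q "join S X P"] join_eq[of X P "join S P Q"] join_eq[of X Q "join S P Q"]
    by metis
  have "point_adj (delete_triangle S A B C) P Q \<longleftrightarrow>
      \<not> inc S A (join S P Q) \<and> \<not> inc S B (join S P Q) \<and> \<not> inc S C (join S P Q)"
  proof -
    have "(\<exists>l\<in>lines S. (\<not> inc S A l \<and> \<not> inc S B l \<and> \<not> inc S C l) \<and> inc S P l \<and> inc S Q l) \<longleftrightarrow>
        \<not> inc S A (join S P Q) \<and> \<not> inc S B (join S P Q) \<and> \<not> inc S C (join S P Q)"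
      using join_line[of P Q] join_eq[OF ne(1) ne(5) False] ne False by metis
    then show ?thesis using False unfolding point_adj_def delete_triangle_def by auto
  qed
  then show ?thesis using through ABC ne by simp
qed

end

theorem theorem11:
  fixes S :: "('p, 'l) incidence_structure" and n :: nat and A B C :: 'p
  assumes "projective_plane_of_order S n"
    and "n \<ge> 5"
    and "A \<in> points S" and "B \<in> points S" and "C \<in> points S"
    and "\<not> collinear3 S A B C"
  shows "strongly_regular_configuration (delete_triangle S A B C)
           ((n - 1)\<^sup>2) (n - 2) ((n - 4)\<^sup>2 + 1) ((n - 3) * (n - 4)) \<and>
         \<not> (\<exists>\<alpha> \<beta>. alpha_beta_geometry (delete_triangle S A B C) \<alpha> \<beta>)"
proof -
  interpret plane_of_order S n by unfold_locales (rule assms(1))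
  have "A \<noteq> B"
  proof
    assume "A = B"
    \<comment> \<open>If \<open>C\<close> also equals \<open>A\<close>, a second point of the plane
      is required to obtain a line through \<open>A\<close>.\<close>
    moreover from plane obtain P Q where "P \<in> points S" "Q \<in> points S" "P \<noteq> Q"
      unfolding projective_plane_of_order_def projective_plane_def by auto
    then have "\<exists>P\<in>points S. P \<noteq> A" by metis
    ultimately show False
      using assms(3-6) join_line[of A C] join_line[of A] unfolding collinear3_def by metis
  qed
  then have t: "triangle A B C"
    using assms(3-6) join_line[of A B] unfolding triangle_def collinear3_def by auto
  interpret three_net "remaining_points A B C" "remaining_pencil A B C" "remaining_pencil B A C"
    "remaining_pencil C A B" "join S A" "join S B" "join S C" "n - 1"
    using three_net_triangle[OF t] assms(2) by simp
  let ?D = "delete_triangle S A B C"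
  have D: "points ?D = remaining_points A B C" "lines ?D = remaining_lines A B C" "inc ?D = inc S"
    unfolding delete_triangle_def remaining_points_def remaining_lines_def by simp_all
  have sub: "remaining_points A B C \<subseteq> points S" "remaining_lines A B C \<subseteq> lines S"
    unfolding remaining_points_def remaining_lines_def by auto
  have adj: "point_adj ?D P Q \<longleftrightarrow> adj P Q"
    if "P \<in> remaining_points A B C" "Q \<in> remaining_points A B C" for P Q
    using point_adj_delete_triangle[OF t that] unfolding adj_def by simp
  have finL: "finite (remaining_lines A B C)" using finite_lines[OF t] sub finite_subset by blast
  have uniq: "l = k" if "P \<in> remaining_points A B C" "Q \<in> remaining_points A B C" "P \<noteq> Q"
      "l \<in> remaining_lines A B C" "k \<in> remaining_lines A B C"
      "inc S P l" "inc S Q l" "inc S P k" "inc S Q k" for P Q l k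
    using line_unique[of P Q l k] that sub by blast
  have conf: "symmetric_configuration ?D ((n - 1)\<^sup>2) (n - 2)"
    unfolding symmetric_configuration_def points_on_def lines_through_def D
    using finite_V card_V finL card_remaining_lines[OF t] assms(2)
      card_points_on_remaining_line[OF t] card_lines_through_remaining_point[OF t]
    by (auto intro: uniq card_ge_0_finite)
  have "strongly_regular_graph (points ?D) adj ((n - 1)\<^sup>2) ((n - 2) * (n - 3))
      ((n - 4)\<^sup>2 + 1) ((n - 3) * (n - 4))"
  proof -
    \<comment> \<open>The net has order \<open>n - 1\<close>, so its parameters are shifted by
      one.\<close>
    have "n - 1 - 1 = n - 2" "n - 1 - 2 = n - 3" "n - 1 - 3 = n - 4" by simp_all
    moreover have "3 \<le> n - 1" using assms(2) by simp
    ultimately show ?thesis using strongly_regular unfolding D by (simp only:)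
  qed
  then have "strongly_regular_graph (points ?D) (point_adj ?D) ((n - 1)\<^sup>2) ((n - 2) * (n - 2 - 1))
      ((n - 4)\<^sup>2 + 1) ((n - 3) * (n - 4))"
    using strongly_regular_graph_cong[of "points ?D" "point_adj ?D" adj] adj unfolding D
    by (simp add: numeral_3_eq_3)
  moreover have "\<not> alpha_beta_geometry ?D \<alpha> \<beta>" for \<alpha> \<beta>
  proof
    assume ab: "alpha_beta_geometry ?D \<alpha> \<beta>"
    have "card (remaining_lines A B C) > 0" using card_remaining_lines[OF t] assms(2) by simp
    then obtain l where l: "l \<in> remaining_lines A B C" by (metis all_not_in_conv card_gt_0_iff)
    let ?W = "{P \<in> remaining_points A B C. inc S P l}"
    \<comment> \<open>The transversal property is applied once from each vertex; it gives the missed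
      members \<open>p\<close>, \<open>q\<close>, \<open>r\<close> of the same line
      \<open>l\<close>.\<close>
    note s2 = triangle_swap(2)[OF t] and s4 = triangle_swap(2)[OF triangle_swap(1)[OF t]]
    have perm: "remaining_points B A C = remaining_points A B C"
      "remaining_points C A B = remaining_points A B C"
      "l \<in> remaining_lines B A C" "l \<in> remaining_lines C A B"
      using l remaining_points_swap unfolding remaining_lines_def by auto
    obtain p where p: "p \<in> remaining_pencil A B C"
        "bij_betw (join S A) ?W (remaining_pencil A B C - {p})"
      using bij_remaining_line[OF t l] assms(2) by auto
    obtain q where q: "q \<in> remaining_pencil B A C"
        "bij_betw (join S B) ?W (remaining_pencil B A C - {q})"
      using bij_remaining_line[OF s2 perm(3)] assms(2) perm(1) by auto
    obtain r where r: "r \<in> remaining_pencil C A B"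
        "bij_betw (join S C) ?W (remaining_pencil C A B - {r})"
      using bij_remaining_line[OF s4 perm(4)] assms(2) perm(2) by auto
    have "\<not> (\<forall>P\<in>remaining_points A B C - ?W. card {Q \<in> ?W. adj P Q} \<in> {\<alpha>, \<beta>})"
      using transversal_neighbour_counts[OF _ p(2) q(2) r(2) p(1) q(1) r(1)] assms(2) by auto
    moreover have "card {Q \<in> ?W. adj P Q} \<in> {\<alpha>, \<beta>}" if "P \<in> remaining_points A B C - ?W" for P
    proof -
      have "{Q \<in> ?W. adj P Q} = {Q \<in> points_on ?D l. point_adj ?D P Q}"
        using that adj unfolding points_on_def D by auto
      then show ?thesis using ab that l unfolding alpha_beta_geometry_def D by auto
    qed
    ultimately show False by blast
  qed
  ultimately show ?thesis using conf unfolding strongly_regular_configuration_def by blast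
qed

end
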